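(* Let $\mathcal{Q}$ be the Poisson algebra of real binary quadratic forms $F=ap^2+2bpq+cq^2$ on the symplectic plane with coordinates $(p,q)$, endowed with the Poisson bracket. Then the algebra $\mathcal{Q}$ is isomorphic to the Lie algebra $\mathbb{R}^3_H$.
   Context: The Poisson bracket on the symplectic plane is $\{F,G\}=\frac{\partial F}{\partial p}\frac{\partial G}{\partial q}-\frac{\partial F}{\partial q}\frac{\partial G}{\partial p}$. $\mathbb{R}^3_H$ is the Lie algebra $\mathbb{R}^3$ with the vector product $(x,y,z)\,\bar\wedge\,(x',y',z')=(yz'-zy',\,zx'-xz',\,-(xy'-yx'))$. *)

theory Defs
  imports "HOL-Analysis.Analysis" "HOL-Library.Function_Algebras"
begin

text \<open>Pointwise scalar multiplication, making functions into a real vector space together with the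
  pointwise operations of \<open>Function_Algebras\<close>.\<close>

instantiation "fun" :: (type, real_vector) real_vector
begin

definition scaleR_fun :: "real \<Rightarrow> ('a \<Rightarrow> 'b) \<Rightarrow> 'a \<Rightarrow> 'b" where
  "scaleR_fun r f = (\<lambda>x. r *\<^sub>R f x)"

instance
  by standard (simp_all add: scaleR_fun_def fun_eq_iff scaleR_add_right scaleR_add_left)

end

text \<open>A real Lie algebra carried by a linear subspace \<open>L\<close> of an ambient real vector space;
  the bracket is only constrained on \<open>L\<close>.\<close>

locale lie_algebra =
  fixes L :: "'a::real_vector set" and bracket :: "'a \<Rightarrow> 'a \<Rightarrow> 'a"
  assumes subspace: "subspace L"
    and closed: "\<lbrakk>x \<in> L; y \<in> L\<rbrakk> \<Longrightarrow> bracket x y \<in> L"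
    and add_left: "\<lbrakk>x \<in> L; y \<in> L; z \<in> L\<rbrakk> \<Longrightarrow> bracket (x + y) z = bracket x z + bracket y z"
    and add_right: "\<lbrakk>x \<in> L; y \<in> L; z \<in> L\<rbrakk> \<Longrightarrow> bracket x (y + z) = bracket x y + bracket x z"
    and scale_left: "\<lbrakk>x \<in> L; y \<in> L\<rbrakk> \<Longrightarrow> bracket (r *\<^sub>R x) y = r *\<^sub>R bracket x y"
    and scale_right: "\<lbrakk>x \<in> L; y \<in> L\<rbrakk> \<Longrightarrow> bracket x (r *\<^sub>R y) = r *\<^sub>R bracket x y"
    and alternating: "x \<in> L \<Longrightarrow> bracket x x = 0"
    and jacobi: "\<lbrakk>x \<in> L; y \<in> L; z \<in> L\<rbrakk> \<Longrightarrow>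
      bracket x (bracket y z) + bracket y (bracket z x) + bracket z (bracket x y) = 0"

definition lie_algebra_iso ::
  "'a::real_vector set \<Rightarrow> ('a \<Rightarrow> 'a \<Rightarrow> 'a) \<Rightarrow> 'b::real_vector set \<Rightarrow> ('b \<Rightarrow> 'b \<Rightarrow> 'b) \<Rightarrow> ('a \<Rightarrow> 'b) \<Rightarrow> bool"
  where
  "lie_algebra_iso L bL M bM \<phi> \<longleftrightarrow>
     bij_betw \<phi> L M \<and>
     (\<forall>x\<in>L. \<forall>y\<in>L. \<phi> (x + y) = \<phi> x + \<phi> y) \<and>
     (\<forall>r. \<forall>x\<in>L. \<phi> (r *\<^sub>R x) = r *\<^sub>R \<phi> x) \<and>
     (\<forall>x\<in>L. \<forall>y\<in>L. \<phi> (bL x y) = bM (\<phi> x) (\<phi> y))"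

definition lie_algebra_isomorphic ::
  "'a::real_vector set \<Rightarrow> ('a \<Rightarrow> 'a \<Rightarrow> 'a) \<Rightarrow> 'b::real_vector set \<Rightarrow> ('b \<Rightarrow> 'b \<Rightarrow> 'b) \<Rightarrow> bool"
  where
  "lie_algebra_isomorphic L bL M bM \<longleftrightarrow>
     lie_algebra L bL \<and> lie_algebra M bM \<and> (\<exists>\<phi>. lie_algebra_iso L bL M bM \<phi>)"

text \<open>Points of the symplectic plane are pairs \<open>(p, q)\<close>.\<close>

definition partial_p :: "(real \<times> real \<Rightarrow> real) \<Rightarrow> real \<times> real \<Rightarrow> real" where
  "partial_p F = (\<lambda>(p, q). deriv (\<lambda>t. F (t, q)) p)"

definition partial_q :: "(real \<times> real \<Rightarrow> real) \<Rightarrow> real \<times> real \<Rightarrow> real" where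
  "partial_q F = (\<lambda>(p, q). deriv (\<lambda>t. F (p, t)) q)"

definition poisson_bracket ::
  "(real \<times> real \<Rightarrow> real) \<Rightarrow> (real \<times> real \<Rightarrow> real) \<Rightarrow> real \<times> real \<Rightarrow> real" where
  "poisson_bracket F G = (\<lambda>z. partial_p F z * partial_q G z - partial_q F z * partial_p G z)"

definition quadratic_form :: "real \<Rightarrow> real \<Rightarrow> real \<Rightarrow> real \<times> real \<Rightarrow> real" where
  "quadratic_form a b c = (\<lambda>(p, q). a * p\<^sup>2 + 2 * b * p * q + c * q\<^sup>2)"

definition quadratic_forms :: "(real \<times> real \<Rightarrow> real) set" where
  "quadratic_forms = {quadratic_form a b c | a b c. True}"

text \<open>The hyperbolic vector product: the usual cross product with its third component negated.\<close>

definition hyp_wedge :: "real^3 \<Rightarrow> real^3 \<Rightarrow> real^3" where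
  "hyp_wedge u v =
     vector [u$2 * v$3 - u$3 * v$2,
             u$3 * v$1 - u$1 * v$3,
             - (u$1 * v$2 - u$2 * v$1)]"

end

theory Submission
  imports Defs
begin

text \<open>
  In terms of coefficients, the bracket of the forms \<open>(a, b, c)\<close> and \<open>(a', b', c')\<close> is the form
  \<open>(4 (a b' - b a'), 2 (a c' - c a'), 4 (b c' - c b'))\<close>.  For the basis
  \<open>P = p\<^sup>2 - q\<^sup>2\<close>, \<open>S = 2 p q\<close>, \<open>N = p\<^sup>2 + q\<^sup>2\<close> this means
  \<open>{P, S} = 4 N\<close>, \<open>{S, N} = - 4 P\<close>, \<open>{N, P} = - 4 S\<close>, which up to a scalar is the multiplication
  table \<open>e\<^sub>1 \<and> e\<^sub>2 = - e\<^sub>3\<close>, \<open>e\<^sub>2 \<and> e\<^sub>3 = e\<^sub>1\<close>, \<open>e\<^sub>3 \<and> e\<^sub>1 = e\<^sub>2\<close> of the hyperbolic vector product;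
  the exceptional sign belongs to the definite form \<open>N\<close>.  Sending \<open>P, S, N\<close> to
  \<open>- 4 e\<^sub>1, - 4 e\<^sub>2, - 4 e\<^sub>3\<close> absorbs the scalar.

  The Lie algebra axioms are polynomial identities in coordinates for the vector product, and the
  quadratic forms inherit them because the isomorphism is injective.
\<close>

text \<open>An identity in \<open>L\<close> may be checked after applying the injective map \<open>\<phi>\<close>, which turns it into
  the same identity in \<open>M\<close>.  Only that \<open>L\<close> is closed under its operations cannot be read off from
  \<open>M\<close>.\<close>

lemma lie_algebra_pullback:
  assumes M: "lie_algebra M bM"
    and iso: "lie_algebra_iso L bL M bM \<phi>"
    and L: "subspace L"
    and closed: "\<And>x y. x \<in> L \<Longrightarrow> y \<in> L \<Longrightarrow> bL x y \<in> L"
  shows "lie_algebra L bL"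
proof -
  interpret M: lie_algebra M bM by (rule M)
  have inj: "x = y" if "\<phi> x = \<phi> y" "x \<in> L" "y \<in> L" for x y
    using iso that by (auto simp: lie_algebra_iso_def bij_betw_def dest: inj_onD)
  have mem: "\<phi> x \<in> M" if "x \<in> L" for x
    using iso that by (auto simp: lie_algebra_iso_def bij_betw_def)
  have add: "\<phi> (x + y) = \<phi> x + \<phi> y" if "x \<in> L" "y \<in> L" for x y
    using iso that by (simp add: lie_algebra_iso_def)
  have scale: "\<phi> (r *\<^sub>R x) = r *\<^sub>R \<phi> x" if "x \<in> L" for r x
    using iso that by (simp add: lie_algebra_iso_def)
  have br: "\<phi> (bL x y) = bM (\<phi> x) (\<phi> y)" if "x \<in> L" "y \<in> L" for x y
    using iso that by (simp add: lie_algebra_iso_def)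
  have zero: "\<phi> 0 = 0"
    using scale[of 0 0] subspace_0[OF L] by simp
  note in_L = closed subspace_add[OF L] subspace_scale[OF L] subspace_0[OF L]
  show ?thesis
  proof
    show "subspace L" by (rule L)
  next
    fix x y assume "x \<in> L" "y \<in> L"
    then show "bL x y \<in> L" by (rule closed)
  next
    fix x y z assume "x \<in> L" "y \<in> L" "z \<in> L"
    then show "bL (x + y) z = bL x z + bL y z"
      by (intro inj) (simp_all add: add br mem in_L M.add_left)
  next
    fix x y z assume "x \<in> L" "y \<in> L" "z \<in> L"
    then show "bL x (y + z) = bL x y + bL x z"
      by (intro inj) (simp_all add: add br mem in_L M.add_right)
  next
    fix x y r assume "x \<in> L" "y \<in> L"
    then show "bL (r *\<^sub>R x) y = r *\<^sub>R bL x y"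
      by (intro inj) (simp_all add: scale br mem in_L M.scale_left)
  next
    fix x y r assume "x \<in> L" "y \<in> L"
    then show "bL x (r *\<^sub>R y) = r *\<^sub>R bL x y"
      by (intro inj) (simp_all add: scale br mem in_L M.scale_right)
  next
    fix x assume "x \<in> L"
    then show "bL x x = 0"
      by (intro inj) (simp_all add: zero br mem in_L M.alternating)
  next
    fix x y z assume "x \<in> L" "y \<in> L" "z \<in> L"
    then show "bL x (bL y z) + bL y (bL z x) + bL z (bL x y) = 0"
      by (intro inj) (simp_all add: zero add br mem in_L M.jacobi)
  qed
qed

lemma lie_algebra_hyp_wedge: "lie_algebra (UNIV :: (real^3) set) hyp_wedge"
  by standard (simp_all add: hyp_wedge_def vec_eq_iff forall_3 algebra_simps)

lemma quadratic_form_add: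
  "quadratic_form a b c + quadratic_form a' b' c' = quadratic_form (a + a') (b + b') (c + c')"
  by (simp add: quadratic_form_def fun_eq_iff algebra_simps)

lemma quadratic_form_scaleR:
  "r *\<^sub>R quadratic_form a b c = quadratic_form (r * a) (r * b) (r * c)"
  by (simp add: quadratic_form_def scaleR_fun_def fun_eq_iff algebra_simps)

lemma subspace_quadratic_forms: "subspace quadratic_forms"
proof (rule subspaceI)
  have "0 = quadratic_form 0 0 0"
    by (simp add: quadratic_form_def fun_eq_iff)
  then show "0 \<in> quadratic_forms"
    unfolding quadratic_forms_def by blast
qed (auto simp: quadratic_forms_def quadratic_form_add quadratic_form_scaleR, blast+)

lemma partial_p_quadratic_form:
  "partial_p (quadratic_form a b c) (p, q) = 2 * (a * p + b * q)"
proof -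
  have "((\<lambda>t. quadratic_form a b c (t, q)) has_field_derivative 2 * (a * p + b * q)) (at p)"
    unfolding quadratic_form_def by (auto intro!: derivative_eq_intros)
  then show ?thesis
    by (simp add: partial_p_def DERIV_imp_deriv)
qed

lemma partial_q_quadratic_form:
  "partial_q (quadratic_form a b c) (p, q) = 2 * (b * p + c * q)"
proof -
  have "((\<lambda>t. quadratic_form a b c (p, t)) has_field_derivative 2 * (b * p + c * q)) (at q)"
    unfolding quadratic_form_def by (auto intro!: derivative_eq_intros)
  then show ?thesis
    by (simp add: partial_q_def DERIV_imp_deriv)
qed

lemma poisson_bracket_quadratic_form:
  "poisson_bracket (quadratic_form a b c) (quadratic_form a' b' c') =
     quadratic_form (4 * (a * b' - b * a')) (2 * (a * c' - c * a')) (4 * (b * c' - c * b'))"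
  by (auto simp: fun_eq_iff poisson_bracket_def partial_p_quadratic_form partial_q_quadratic_form)
     (simp add: quadratic_form_def algebra_simps power2_eq_square)

text \<open>The linear map \<open>P, S, N \<mapsto> - 4 e\<^sub>1, - 4 e\<^sub>2, - 4 e\<^sub>3\<close>.  The coefficients of a form \<open>F\<close> are recovered
  from its values by \<open>a = F (1, 0)\<close>, \<open>c = F (0, 1)\<close> and \<open>4 b = F (1, 1) - F (1, - 1)\<close>.\<close>

definition form_vector :: "(real \<times> real \<Rightarrow> real) \<Rightarrow> real^3" where
  "form_vector F =
     vector [2 * (F (0, 1) - F (1, 0)), F (1, - 1) - F (1, 1), - 2 * (F (1, 0) + F (0, 1))]"

lemma form_vector_quadratic_form:
  "form_vector (quadratic_form a b c) = vector [2 * (c - a), - 4 * b, - 2 * (a + c)]"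
  by (simp add: form_vector_def quadratic_form_def)

lemma bij_betw_form_vector: "bij_betw form_vector quadratic_forms UNIV"
proof (rule bij_betw_byWitness)
  let ?g = "\<lambda>u :: real^3. quadratic_form (- (u$1 + u$3) / 4) (- u$2 / 4) ((u$1 - u$3) / 4)"
  show "\<forall>F\<in>quadratic_forms. ?g (form_vector F) = F"
    by (auto simp: quadratic_forms_def form_vector_quadratic_form)
  show "\<forall>u\<in>UNIV. form_vector (?g u) = u"
    by (simp add: form_vector_quadratic_form vec_eq_iff forall_3 field_simps)
  show "?g ` UNIV \<subseteq> quadratic_forms"
    by (auto simp: quadratic_forms_def)
qed simp

lemma lie_algebra_iso_form_vector:
  "lie_algebra_iso quadratic_forms poisson_bracket UNIV hyp_wedge form_vector"
  unfolding lie_algebra_iso_def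
proof (intro conjI ballI allI)
  show "bij_betw form_vector quadratic_forms UNIV"
    by (rule bij_betw_form_vector)
next
  fix F G
  show "form_vector (F + G) = form_vector F + form_vector G"
    by (simp add: form_vector_def vec_eq_iff forall_3)
next
  fix r F
  show "form_vector (r *\<^sub>R F) = r *\<^sub>R form_vector F"
    by (simp add: form_vector_def scaleR_fun_def vec_eq_iff forall_3 algebra_simps)
next
  fix F G assume "F \<in> quadratic_forms" "G \<in> quadratic_forms"
  then show "form_vector (poisson_bracket F G) = hyp_wedge (form_vector F) (form_vector G)"
    by (auto simp: quadratic_forms_def poisson_bracket_quadratic_form form_vector_quadratic_form
        hyp_wedge_def vec_eq_iff forall_3 algebra_simps)
qed

theorem proposition2p6:
  shows "lie_algebra_isomorphic quadratic_forms poisson_bracket (UNIV :: (real^3) set) hyp_wedge"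
proof -
  have "lie_algebra quadratic_forms poisson_bracket"
    using lie_algebra_hyp_wedge lie_algebra_iso_form_vector subspace_quadratic_forms
  proof (rule lie_algebra_pullback)
    fix F G assume "F \<in> quadratic_forms" "G \<in> quadratic_forms"
    then show "poisson_bracket F G \<in> quadratic_forms"
      by (auto simp: quadratic_forms_def poisson_bracket_quadratic_form)
         blast
  qed
  then show ?thesis
    using lie_algebra_hyp_wedge lie_algebra_iso_form_vector
    by (auto simp: lie_algebra_isomorphic_def)
qed

end
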